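(* For $\lambda\in\mathbb{R}$ let $$M_\lambda(x,y,z)=\begin{pmatrix} x^2+(\lambda+1)z^2 & -xy & -xz\\ -xy & y^2+(\lambda+1)x^2 & -yz\\ -xz & -yz & z^2+(\lambda+1)y^2\end{pmatrix}\in\mathbb{R}[x,y,z]^{3\times 3}.$$ Then: (1) for every $\lambda\in\mathbb{R}$, $M_\lambda$ is not a sum of squares; (2) $M_\lambda$ is positive semi-definite if and only if $\lambda\in[0,+\infty[$; (3) the polynomial $\det(M_0)\in\mathbb{R}[x,y,z]$ is non-negative on $\mathbb{R}^3$ and is not a sum of squares of polynomials; (4) $M_\lambda$ admits a semi-certificate of positivity for every $\lambda\in\,]0,+\infty[$.
   Context: A symmetric matrix polynomial $M\in\mathbb{R}[x,y,z]^{3\times 3}$ is a sum of squares if $M=\sum_{i=1}^r U_i^TU_i$ for some $r\in\mathbb{N}$ and $U_1,\ldots,U_r\in\mathbb{R}[x,y,z]^{3\times 3}$. It is positive semi-definite if the real matrix $M(p)$ is positive semi-definite for every $p\in\mathbb{R}^3$. A symmetric matrix polynomial $M$ whose entries are forms (homogeneous polynomials) of the same degree admits a semi-certificate of positivity if there exist a finite covering $\mathbb{R}^3=S_1\cup\cdots\cup S_r$ by semi-algebraic subsets and, for each $i$, finitely many forms $f_{i,j}\in\mathbb{R}[x,y,z]$ and matrix polynomials $U_{i,j}\in\mathbb{R}[x,y,z]^{3\times 3}$ with homogeneous entries ($1\le j\le r_i$), with $\deg f_{i,j}$ plus twice the degree of the entries of $U_{i,j}$ equal to the degree of the entries of $M$,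 such that $M(p)=\sum_{j=1}^{r_i}f_{i,j}(p)\,U_{i,j}(p)^TU_{i,j}(p)$ for all $p\in S_i$ and $f_{i,j}(p)\ge 0$ for all $p\in S_i$ and all $j$. *)

theory Defs
  imports "HOL-Analysis.Analysis" "HOL-Library.Poly_Mapping"
begin

text \<open>The polynomial ring in three variables over the reals is the monoid algebra of
  the exponent vectors \<^typ>\<open>3 \<Rightarrow>\<^sub>0 nat\<close>. The variables x, y, z carry the indices 1, 2, 3
  of the type \<^typ>\<open>3\<close> (where 3 = 0), in agreement with the components of \<^typ>\<open>real^3\<close>.\<close>

type_synonym poly3 = "(3 \<Rightarrow>\<^sub>0 nat) \<Rightarrow>\<^sub>0 real"

definition Var :: "3 \<Rightarrow> poly3"
  where "Var i = Poly_Mapping.single (Poly_Mapping.single i 1) 1"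

definition Const :: "real \<Rightarrow> poly3"
  where "Const c = Poly_Mapping.single 0 c"

definition peval :: "poly3 \<Rightarrow> real^3 \<Rightarrow> real"
  where "peval f p =
    (\<Sum>m\<in>Poly_Mapping.keys f. Poly_Mapping.lookup f m * (\<Prod>i\<in>UNIV. p $ i ^ Poly_Mapping.lookup m i))"

definition meval :: "poly3^3^3 \<Rightarrow> real^3 \<Rightarrow> real^3^3"
  where "meval M p = (\<chi> i j. peval (M $ i $ j) p)"

text \<open>The zero polynomial is a form of every degree.\<close>

definition form :: "nat \<Rightarrow> poly3 \<Rightarrow> bool"
  where "form d f \<longleftrightarrow>
    (\<forall>m\<in>Poly_Mapping.keys f. (\<Sum>i\<in>UNIV. Poly_Mapping.lookup m i) = d)"

definition mform :: "nat \<Rightarrow> poly3^3^3 \<Rightarrow> bool"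
  where "mform d M \<longleftrightarrow> (\<forall>i j. form d (M $ i $ j))"

definition sos_poly :: "poly3 \<Rightarrow> bool"
  where "sos_poly f \<longleftrightarrow> (\<exists>(r::nat) (g :: nat \<Rightarrow> poly3). f = (\<Sum>i<r. (g i)\<^sup>2))"

definition sos_matrix :: "poly3^3^3 \<Rightarrow> bool"
  where "sos_matrix M \<longleftrightarrow> (\<exists>(r::nat) (U :: nat \<Rightarrow> poly3^3^3). M = (\<Sum>i<r. transpose (U i) ** U i))"

definition psd :: "real^3^3 \<Rightarrow> bool"
  where "psd A \<longleftrightarrow> transpose A = A \<and> (\<forall>v. 0 \<le> v \<bullet> (A *v v))"

definition psd_matrix_poly :: "poly3^3^3 \<Rightarrow> bool"
  where "psd_matrix_poly M \<longleftrightarrow> (\<forall>p. psd (meval M p))"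

text \<open>The smallest class of sets containing all sets of the form f > 0 and closed under finite
  Boolean operations; finite unions come from complements and intersections.\<close>

inductive semialgebraic :: "(real^3) set \<Rightarrow> bool"
  where
    pos: "semialgebraic {p. 0 < peval f p}"
  | compl: "semialgebraic S \<Longrightarrow> semialgebraic (- S)"
  | inter: "semialgebraic S \<Longrightarrow> semialgebraic T \<Longrightarrow> semialgebraic (S \<inter> T)"

text \<open>The degree d of the entries is determined by M unless M = 0. The degrees a and b may
  differ between the summands.\<close>

definition semi_certificate :: "poly3^3^3 \<Rightarrow> bool"
  where "semi_certificate M \<longleftrightarrow>
    transpose M = M \<and>
    (\<exists>d. mform d M \<and>
      (\<exists>(r::nat) (S :: nat \<Rightarrow> (real^3) set).
        (\<Union>i<r. S i) = UNIV \<and>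
        (\<forall>i<r. semialgebraic (S i) \<and>
          (\<exists>(n::nat) (f :: nat \<Rightarrow> poly3) (U :: nat \<Rightarrow> poly3^3^3).
            (\<forall>j<n. \<exists>a b. form a (f j) \<and> mform b (U j) \<and> a + 2 * b = d) \<and>
            (\<forall>p\<in>S i.
              meval M p =
                (\<Sum>j<n. peval (f j) p *\<^sub>R (transpose (meval (U j) p) ** meval (U j) p)) \<and>
              (\<forall>j<n. 0 \<le> peval (f j) p))))))"

definition Mlam :: "real \<Rightarrow> poly3^3^3"
  where "Mlam l = (let x = Var 1; y = Var 2; z = Var 3; c = Const (l + 1) in
    vector [
      vector [x\<^sup>2 + c * z\<^sup>2, - (x * y), - (x * z)],
      vector [- (x * y), y\<^sup>2 + c * x\<^sup>2, - (y * z)],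
      vector [- (x * z), - (y * z), z\<^sup>2 + c * y\<^sup>2]])"

end

theory Submission
  imports Defs
begin

text \<open>Write \<open>\<mu> = \<lambda> + 1\<close>, \<open>p = (x, y, z)\<close> and \<open>v = (a, b, c)\<close>. The biquadratic form
  \<open>v\<^sup>T M\<^sub>\<lambda>(p) v\<close> is Choi's form
  \<open>x\<^sup>2a\<^sup>2 + y\<^sup>2b\<^sup>2 + z\<^sup>2c\<^sup>2 - 2xyab - 2xzac - 2yzbc + \<mu>(z\<^sup>2a\<^sup>2 + x\<^sup>2b\<^sup>2 + y\<^sup>2c\<^sup>2)\<close>,
  invariant under the cyclic shift of \<open>(x, y, z)\<close> and \<open>(a, b, c)\<close>; since \<open>3 = 0\<close> in the index
  type, the shift is \<open>i \<mapsto> i + 1\<close>, and \<open>(i, i + 1, i + 2)\<close> always stands for \<open>(x, y, z)\<close> up to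
  rotation.

  No sum of squares. If \<open>M\<^sub>\<lambda> = \<Sum> U\<^sup>T U\<close>, the diagonal entries of \<open>M\<^sub>\<lambda>\<close> exclude
  constant terms from the \<open>U\<close>, and linear terms in \<open>y\<close> from the first columns, in \<open>z\<close> from the
  second and in \<open>x\<close> from the third. The coefficients of \<open>x\<close>, \<open>y\<close>, \<open>z\<close> in the first, second
  and third columns then form three unit vectors with pairwise inner products \<open>-1\<close>, whose sum would have squared
  length \<open>3 - 6 < 0\<close>.

  The determinant. With \<open>X = x\<^sup>2\<close>, \<open>Y = y\<^sup>2\<close>, \<open>Z = z\<^sup>2\<close>,
  \<open>det M\<^sub>\<lambda> = (\<mu>\<^sup>3 - 4)XYZ + \<mu>\<^sup>2(X\<^sup>2Y + Y\<^sup>2Z + Z\<^sup>2X)\<close>, which at \<open>\<lambda> = 0\<close> is the Choi-Lam form. It is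
  non-negative by the inequality of the means. In a representation as \<open>\<Sum> g\<^sup>2\<close> the exponents of
  each \<open>g\<close> lie in half the Newton polytope, the triangle with vertices \<open>x\<^sup>2y\<close>, \<open>y\<^sup>2z\<close>,
  \<open>z\<^sup>2x\<close>, whose only other lattice point is \<open>xyz\<close>. So the coefficient \<open>-3\<close> of \<open>x\<^sup>2y\<^sup>2z\<^sup>2\<close>
  would be a sum of squares of real numbers.

  The semi-certificate for \<open>\<lambda> > 0\<close>. Completing squares gives an explicit certificate on each of
  the three corner regions \<open>4z\<^sup>2 \<le> \<mu>\<^sup>2x\<^sup>2\<close>, \<open>4x\<^sup>2 \<le> \<mu>\<^sup>2y\<^sup>2\<close>, \<open>4y\<^sup>2 \<le> \<mu>\<^sup>2z\<^sup>2\<close>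
  (\<open>corner_certifies\<close>). Outside them no coordinate vanishes. There, up to signs, \<open>M\<^sub>\<lambda>(p)\<close> is a
  Stieltjes matrix (positive definite with off-diagonal entries \<open>\<le> 0\<close>), and for every vector \<open>w\<close>
  without zero entries
  \<open>M = \<Sum>\<^sub>i ((M w)\<^sub>i / w\<^sub>i) e\<^sub>i e\<^sub>i\<^sup>T + \<Sum>\<^sub>i\<^sub><\<^sub>j (-M\<^sub>i\<^sub>j w\<^sub>i w\<^sub>j) (e\<^sub>i/w\<^sub>i - e\<^sub>j/w\<^sub>j) (e\<^sub>i/w\<^sub>i - e\<^sub>j/w\<^sub>j)\<^sup>T\<close>.
  Taking \<open>w = adj(M(p\<^sub>0)) p\<^sub>0\<close> makes all six quadratic weights positive at \<open>p\<^sub>0\<close>, hence on an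
  open cone around \<open>p\<^sub>0\<close>; compactness of the sphere leaves finitely many such cones.

  Semi-definiteness. A semi-certificate forces semi-definiteness, which gives the case \<open>\<lambda> > 0\<close>;
  the case \<open>\<lambda> = 0\<close> is a limit, and for \<open>\<lambda> < 0\<close> the value \<open>3\<lambda>\<close> at \<open>p = v = (1, 1, 1)\<close> is
  negative.\<close>

section \<open>Evaluation of polynomials\<close>

lemma sum_of_singles: "f = (\<Sum>m\<in>Poly_Mapping.keys f. Poly_Mapping.single m (Poly_Mapping.lookup f m))"
proof (rule poly_mapping_eqI)
  fix k
  have "Poly_Mapping.lookup f k = (\<Sum>m\<in>Poly_Mapping.keys f. if m = k then Poly_Mapping.lookup f m else 0)"
    by (simp add: in_keys_iff)
  also have "\<dots> = Poly_Mapping.lookup (\<Sum>m\<in>Poly_Mapping.keys f. Poly_Mapping.single m (Poly_Mapping.lookup f m)) k"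
    by (simp add: lookup_sum lookup_single when_def)
  finally show "Poly_Mapping.lookup f k = \<dots>" .
qed

lemma poly_mapping_single_induct [case_names zero single add]:
  fixes f :: "'a \<Rightarrow>\<^sub>0 'b::comm_monoid_add"
  assumes "P 0" and "\<And>m c. P (Poly_Mapping.single m c)" and "\<And>f g. P f \<Longrightarrow> P g \<Longrightarrow> P (f + g)"
  shows "P f"
proof -
  have "P (\<Sum>m\<in>I. Poly_Mapping.single m (Poly_Mapping.lookup f m))" if "finite I" for I
    using that by induction (auto intro: assms)
  then show ?thesis by (subst sum_of_singles) simp
qed

definition monomial_value :: "(3 \<Rightarrow>\<^sub>0 nat) \<Rightarrow> real^3 \<Rightarrow> real"
  where "monomial_value m p = (\<Prod>i\<in>UNIV. p $ i ^ Poly_Mapping.lookup m i)"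

lemma peval_alt: "peval f p = (\<Sum>m\<in>Poly_Mapping.keys f. Poly_Mapping.lookup f m * monomial_value m p)"
  by (simp add: peval_def monomial_value_def)

lemma peval_single [simp]: "peval (Poly_Mapping.single m c) p = c * monomial_value m p"
  by (simp add: peval_alt)

lemma peval_0 [simp]: "peval 0 p = 0"
  by (simp add: peval_def)

lemma peval_add [simp]: "peval (f + g) p = peval f p + peval g p"
  unfolding peval_alt by (rule setsum_keys_plus_distrib) (simp_all add: algebra_simps)

lemma peval_mult [simp]: "peval (f * g) p = peval f p * peval g p"
proof (induction f rule: poly_mapping_single_induct)
  case (single m c)
  show ?case
    by (induction g rule: poly_mapping_single_induct)
      (simp_all add: mult_single monomial_value_def lookup_add power_add prod.distrib algebra_simps)
qed (simp_all add: algebra_simps)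

lemma peval_uminus [simp]: "peval (- f) p = - peval f p"
  using peval_add[of f "- f" p] by simp

lemma peval_diff [simp]: "peval (f - g) p = peval f p - peval g p"
  using peval_add[of f "- g" p] by simp

lemma peval_Const [simp]: "peval (Const c) p = c"
  by (simp add: Const_def monomial_value_def)

lemma peval_1 [simp]: "peval 1 p = 1"
  using peval_Const[of 1 p] by (simp add: Const_def)

lemma peval_Var [simp]: "peval (Var i) p = p $ i"
proof -
  have "(\<Prod>j\<in>UNIV. p $ j ^ (1 when i = j)) = (\<Prod>j\<in>UNIV. if j = i then p $ j else 1)"
    by (intro prod.cong) (auto simp: when_def)
  then show ?thesis
    by (simp add: Var_def monomial_value_def lookup_single)
qed

lemma peval_power [simp]: "peval (f ^ n) p = peval f p ^ n"
  by (induction n) simp_all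

lemma peval_sum [simp]: "peval (sum f I) p = (\<Sum>i\<in>I. peval (f i) p)"
  by (induction I rule: infinite_finite_induct) simp_all

lemma continuous_on_peval: "continuous_on A (peval f)"
  unfolding peval_def by (intro continuous_intros)

section \<open>Forms\<close>

lemma form_0 [simp]: "form d 0"
  by (simp add: form_def)

lemma form_add: "form d f \<Longrightarrow> form d g \<Longrightarrow> form d (f + g)"
  using keys_add[of f g] by (auto simp: form_def)

lemma form_uminus [simp]: "form d (- f) \<longleftrightarrow> form d f"
  by (simp add: form_def in_keys_iff)

lemma form_diff: "form d f \<Longrightarrow> form d g \<Longrightarrow> form d (f - g)"
  using form_add[of d f "- g"] by simp

lemma form_mult: "form d f \<Longrightarrow> form e g \<Longrightarrow> form (d + e) (f * g)"
  using keys_mult[of f g] by (fastforce simp: form_def lookup_add sum.distrib)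

lemma form_power: "form d f \<Longrightarrow> form (d * n) (f ^ n)"
proof (induction n)
  case 0
  then show ?case by (simp add: form_def)
next
  case (Suc n)
  then show ?case using form_mult[of d f "d * n" "f ^ n"] by simp
qed

lemma form_Const [simp]: "form 0 (Const c)"
  by (simp add: form_def Const_def)

lemma form_1 [simp]: "form 0 1"
  by (simp add: form_def)

lemma form_Var [simp]: "form (Suc 0) (Var i)"
  by (simp add: form_def Var_def lookup_single when_def)

lemma peval_form_scaleR:
  assumes "form d f" shows "peval f (t *\<^sub>R p) = t ^ d * peval f p"
proof -
  have "peval f (t *\<^sub>R p) = (\<Sum>m\<in>Poly_Mapping.keys f. t ^ d * (Poly_Mapping.lookup f m * monomial_value m p))"
    unfolding peval_alt
  proof (rule sum.cong)
    fix m assume "m \<in> Poly_Mapping.keys f"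
    with assms have "(\<Prod>i\<in>UNIV. t ^ Poly_Mapping.lookup m i) = t ^ d"
      by (simp add: form_def flip: power_sum)
    then show "Poly_Mapping.lookup f m * monomial_value m (t *\<^sub>R p) =
        t ^ d * (Poly_Mapping.lookup f m * monomial_value m p)"
      by (simp add: monomial_value_def power_mult_distrib prod.distrib)
  qed simp
  then show ?thesis by (simp add: peval_alt sum_distrib_left)
qed

section \<open>Coefficients\<close>

definition exps :: "nat \<Rightarrow> nat \<Rightarrow> nat \<Rightarrow> 3 \<Rightarrow>\<^sub>0 nat"
  where "exps a b c = Poly_Mapping.single 1 a + Poly_Mapping.single 2 b + Poly_Mapping.single 3 c"

definition coef :: "poly3 \<Rightarrow> nat \<Rightarrow> nat \<Rightarrow> nat \<Rightarrow> real"
  where "coef f a b c = Poly_Mapping.lookup f (exps a b c)"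

lemma lookup_exps: "Poly_Mapping.lookup (exps a b c) 1 = a"
    "Poly_Mapping.lookup (exps a b c) 2 = b" "Poly_Mapping.lookup (exps a b c) 3 = c"
  by (simp_all add: exps_def lookup_add lookup_single)

lemma exps_inject [simp]: "exps a b c = exps a' b' c' \<longleftrightarrow> a = a' \<and> b = b' \<and> c = c'"
  by (metis lookup_exps)

lemma exps_surj: "\<exists>a b c. m = exps a b c"
proof (intro exI)
  show "m = exps (Poly_Mapping.lookup m 1) (Poly_Mapping.lookup m 2) (Poly_Mapping.lookup m 3)"
    by (rule poly_mapping_eqI) (metis exhaust_3 lookup_exps)
qed

lemma exps_add: "exps a b c + exps a' b' c' = exps (a + a') (b + b') (c + c')"
  by (simp add: exps_def single_add ac_simps)

lemma exps_0: "exps 0 0 0 = 0"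
  by (simp add: exps_def)

lemma coef_simps [simp]:
  "coef 0 a b c = 0"
  "coef (f + g) a b c = coef f a b c + coef g a b c"
  "coef (f - g) a b c = coef f a b c - coef g a b c"
  "coef (- f) a b c = - coef f a b c"
  "coef (sum h I) a b c = (\<Sum>i\<in>I. coef (h i) a b c)"
  by (simp_all add: coef_def lookup_add lookup_minus lookup_sum)

lemma coef_single: "coef (Poly_Mapping.single (exps a' b' c') u) a b c =
    (if a = a' \<and> b = b' \<and> c = c' then u else 0)"
  by (auto simp: coef_def lookup_single when_def)

lemma sum_delta3:
  fixes t :: "nat \<Rightarrow> nat \<Rightarrow> nat \<Rightarrow> real"
  shows "(\<Sum>i\<le>a. \<Sum>j\<le>b. \<Sum>k\<le>c. if i = m1 \<and> j = m2 \<and> k = m3 then t i j k else 0) =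
    (if m1 \<le> a \<and> m2 \<le> b \<and> m3 \<le> c then t m1 m2 m3 else 0)"
proof -
  have 1: "(\<Sum>k\<le>c. if i = m1 \<and> j = m2 \<and> k = m3 then t i j k else 0) =
      (if i = m1 \<and> j = m2 then if m3 \<le> c then t i j m3 else 0 else 0)" for i j
    by (cases "i = m1 \<and> j = m2") auto
  have 2: "(\<Sum>j\<le>b. if i = m1 \<and> j = m2 then if m3 \<le> c then t i j m3 else 0 else 0) =
      (if i = m1 then if m2 \<le> b \<and> m3 \<le> c then t i m2 m3 else 0 else 0)" for i
    by (cases "i = m1") auto
  show ?thesis unfolding 1 2 by auto
qed

text \<open>Expanding a product coefficient into this finite sum lets the simplifier do the coefficient
  comparisons below.\<close>

lemma coef_mult:
  "coef (f * g) a b c =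
    (\<Sum>i\<le>a. \<Sum>j\<le>b. \<Sum>k\<le>c. coef f i j k * coef g (a - i) (b - j) (c - k))"
proof (induction f rule: poly_mapping_single_induct)
  case (single m u)
  obtain m1 m2 m3 where m: "m = exps m1 m2 m3" using exps_surj by blast
  show ?case
  proof (induction g rule: poly_mapping_single_induct)
    case (single n v)
    obtain n1 n2 n3 where n: "n = exps n1 n2 n3" using exps_surj by blast
    have "(\<Sum>i\<le>a. \<Sum>j\<le>b. \<Sum>k\<le>c. coef (Poly_Mapping.single m u) i j k *
            coef (Poly_Mapping.single n v) (a - i) (b - j) (c - k)) =
      (\<Sum>i\<le>a. \<Sum>j\<le>b. \<Sum>k\<le>c. if i = m1 \<and> j = m2 \<and> k = m3
        then u * coef (Poly_Mapping.single n v) (a - i) (b - j) (c - k) else 0)"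
      unfolding m coef_single by (intro sum.cong) auto
    also have "\<dots> = (if m1 \<le> a \<and> m2 \<le> b \<and> m3 \<le> c
        then u * coef (Poly_Mapping.single n v) (a - m1) (b - m2) (c - m3) else 0)"
      by (simp add: sum_delta3)
    also have "\<dots> = coef (Poly_Mapping.single m u * Poly_Mapping.single n v) a b c"
      unfolding m n mult_single exps_add coef_single by auto
    finally show ?case by simp
  qed (simp_all add: algebra_simps sum.distrib)
qed (simp_all add: algebra_simps sum.distrib)

lemma Var_exps: "Var 1 = Poly_Mapping.single (exps 1 0 0) 1" "Var 2 = Poly_Mapping.single (exps 0 1 0) 1"
  "Var 3 = Poly_Mapping.single (exps 0 0 1) 1"
  by (simp_all add: Var_def exps_def)

lemma Const_exps: "Const c = Poly_Mapping.single (exps 0 0 0) c"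
  by (simp add: Const_def exps_0)

section \<open>The matrices and their determinants\<close>

text \<open>The cyclic symmetry of the matrices is index arithmetic modulo 3.\<close>

lemma numeral_mod_3 [simp]: "(4::3) = 1" "(5::3) = 2"
  by simp_all

lemma Mlam_nth: "Mlam l $ i $ j =
    (if i = j then (Var i)\<^sup>2 + Const (l + 1) * (Var (i + 2))\<^sup>2 else - (Var i * Var j))"
  using exhaust_3[of i] exhaust_3[of j] by (auto simp: Mlam_def Let_def algebra_simps)

lemma det_Mlam: "det (Mlam l) = Const ((l + 1)^3 - 4) * (Var 1 * Var 2 * Var 3)\<^sup>2
    + Const ((l + 1)\<^sup>2) * (((Var 1)\<^sup>2)\<^sup>2 * (Var 2)\<^sup>2 + ((Var 2)\<^sup>2)\<^sup>2 * (Var 3)\<^sup>2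
      + ((Var 3)\<^sup>2)\<^sup>2 * (Var 1)\<^sup>2)"
proof -
  have c: "Const ((l + 1)\<^sup>2) = (Const (l + 1))^2" "Const ((l + 1)^3 - 4) = (Const (l + 1))^3 - 4"
    by (simp_all add: Const_def mult_single power2_eq_square power3_eq_cube single_diff)
  show ?thesis unfolding c
    by (simp add: det_3 Mlam_nth power2_eq_square power3_eq_cube algebra_simps)
qed

lemma peval_Mlam: "peval (Mlam l $ i $ j) p =
    (if i = j then (p $ i)\<^sup>2 + (l + 1) * (p $ (i + 2))\<^sup>2 else - (p $ i * p $ j))"
  by (simp add: Mlam_nth)

lemma cyclic_amgm:
  fixes X Y Z :: real
  assumes "0 \<le> X" "0 \<le> Y" "0 \<le> Z"
  shows "3 * X * Y * Z \<le> X\<^sup>2 * Y + Y\<^sup>2 * Z + Z\<^sup>2 * X"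
proof -
  \<comment> \<open>The difference of the two sides is \<open>Y(X - Z)\<^sup>2 + Z(Y - X)(Y - Z)\<close>, and by cyclic symmetry
    \<open>Y\<close> may be taken to be the largest variable.\<close>
  have *: "3 * X * Y * Z \<le> X\<^sup>2 * Y + Y\<^sup>2 * Z + Z\<^sup>2 * X" if "0 \<le> X" "X \<le> Y" "0 \<le> Z" "Z \<le> Y" for X Y Z :: real
  proof -
    have "0 \<le> Y * (X - Z)\<^sup>2 + Z * ((Y - X) * (Y - Z))"
      using that by (intro add_nonneg_nonneg mult_nonneg_nonneg) auto
    then show ?thesis by (simp add: power2_eq_square algebra_simps)
  qed
  consider "X \<le> Y" "Z \<le> Y" | "X \<le> Z" "Y \<le> Z" | "Y \<le> X" "Z \<le> X" by linarith
  then show ?thesis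
    using *[of X Y Z] *[of Y Z X] *[of Z X Y] assms by cases (simp_all add: algebra_simps)
qed

lemma peval_det_Mlam:
  "peval (det (Mlam l)) p = ((l + 1)^3 - 4) * (p $ 1)\<^sup>2 * (p $ 2)\<^sup>2 * (p $ 3)\<^sup>2
    + (l + 1)\<^sup>2 * (((p $ 1)\<^sup>2)\<^sup>2 * (p $ 2)\<^sup>2 + ((p $ 2)\<^sup>2)\<^sup>2 * (p $ 3)\<^sup>2
      + ((p $ 3)\<^sup>2)\<^sup>2 * (p $ 1)\<^sup>2)"
  by (simp add: det_Mlam power_mult_distrib)

lemma peval_det_Mlam_ge:
  assumes "0 \<le> l"
  shows "((l + 1)^3 + 3 * (l + 1)^2 - 4) * ((p $ 1)\<^sup>2 * (p $ 2)\<^sup>2 * (p $ 3)\<^sup>2) \<le> peval (det (Mlam l)) p"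
proof -
  have "(l + 1)\<^sup>2 * (3 * (p $ 1)\<^sup>2 * (p $ 2)\<^sup>2 * (p $ 3)\<^sup>2) \<le>
      (l + 1)\<^sup>2 * (((p $ 1)\<^sup>2)\<^sup>2 * (p $ 2)\<^sup>2 + ((p $ 2)\<^sup>2)\<^sup>2 * (p $ 3)\<^sup>2 + ((p $ 3)\<^sup>2)\<^sup>2 * (p $ 1)\<^sup>2)"
    by (intro mult_left_mono cyclic_amgm) auto
  then show ?thesis by (simp add: peval_det_Mlam algebra_simps)
qed

lemma peval_det_Mlam_pos:
  assumes "0 < l" "\<And>i. p $ i \<noteq> 0" shows "0 < peval (det (Mlam l)) p"
proof -
  have "0 < (l + 1)^3 + 3 * (l + 1)^2 - 4"
    using assms(1) by (simp add: power2_eq_square power3_eq_cube algebra_simps add_pos_pos)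
  then have "0 < ((l + 1)^3 + 3 * (l + 1)^2 - 4) * ((p $ 1)\<^sup>2 * (p $ 2)\<^sup>2 * (p $ 3)\<^sup>2)"
    using assms(2) by (intro mult_pos_pos) auto
  also have "\<dots> \<le> peval (det (Mlam l)) p" using assms by (intro peval_det_Mlam_ge) auto
  finally show ?thesis .
qed

section \<open>No sums of squares\<close>

text \<open>\<open>A\<close>, \<open>B\<close> and \<open>C\<close> list the entries of the three columns of all the matrices in a
  decomposition into squares.\<close>

lemma Mlam_not_gram_matrix:
  fixes A B C :: "'i \<Rightarrow> poly3"
  assumes "finite I"
  assumes "(\<Sum>i\<in>I. A i * A i) = Mlam l $ 1 $ 1" "(\<Sum>i\<in>I. B i * B i) = Mlam l $ 2 $ 2"
    "(\<Sum>i\<in>I. C i * C i) = Mlam l $ 3 $ 3" "(\<Sum>i\<in>I. A i * B i) = Mlam l $ 1 $ 2"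
    "(\<Sum>i\<in>I. A i * C i) = Mlam l $ 1 $ 3" "(\<Sum>i\<in>I. B i * C i) = Mlam l $ 2 $ 3"
  shows False
proof -
  (* The six hypotheses, read as equations between coefficients. *)
  note e = assms(2-)[THEN arg_cong, of coef, THEN fun_cong, THEN fun_cong, THEN fun_cong]
  have sq: "(\<Sum>i\<in>I. q i * q i) = 0 \<Longrightarrow> \<forall>i\<in>I. q i = 0" for q :: "'i \<Rightarrow> real"
    using assms(1) by (simp add: sum_nonneg_eq_0_iff)
  note s = Mlam_nth Var_exps Const_exps power2_eq_square mult_single exps_add coef_single coef_mult
  have 0: "\<forall>i\<in>I. coef (A i) 0 0 0 = 0" "\<forall>i\<in>I. coef (B i) 0 0 0 = 0"  "\<forall>i\<in>I. coef (C i) 0 0 0 = 0"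
    using e(1-3)[of 0 0 0] by (auto simp: s intro!: sq)
  \<comment> \<open>The squares of \<open>y\<close>, \<open>z\<close>, \<open>x\<close> are missing from the first, second and third
    diagonal entry.\<close>
  have 1: "\<forall>i\<in>I. coef (A i) 0 1 0 = 0" "\<forall>i\<in>I. coef (B i) 0 0 1 = 0"  "\<forall>i\<in>I. coef (C i) 1 0 0 = 0"
    using e(1)[of 0 2 0] e(2)[of 0 0 2] e(3)[of 2 0 0] 0
    by (auto simp: s numeral_2_eq_2 intro!: sq)
  have 2: "(\<Sum>i\<in>I. coef (A i) 1 0 0 * coef (A i) 1 0 0) = 1" "(\<Sum>i\<in>I. coef (B i) 0 1 0 * coef (B i) 0 1 0) = 1"
      "(\<Sum>i\<in>I. coef (C i) 0 0 1 * coef (C i) 0 0 1) = 1"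
    using e(1)[of 2 0 0] e(2)[of 0 2 0] e(3)[of 0 0 2] 0 1
    by (auto simp: s numeral_2_eq_2)
  have 3: "(\<Sum>i\<in>I. coef (A i) 1 0 0 * coef (B i) 0 1 0) = - 1"  "(\<Sum>i\<in>I. coef (A i) 1 0 0 * coef (C i) 0 0 1) = - 1"
     "(\<Sum>i\<in>I. coef (B i) 0 1 0 * coef (C i) 0 0 1) = - 1"
    using e(4)[of 1 1 0] e(5)[of 1 0 1] e(6)[of 0 1 1] 0 1
    by (auto simp: s)
  \<comment> \<open>Three unit vectors with pairwise inner products \<open>-1\<close> would have a sum of squared length
    \<open>3 - 6\<close>.\<close>
  have "0 \<le> (\<Sum>i\<in>I. (coef (A i) 1 0 0 + coef (B i) 0 1 0 + coef (C i) 0 0 1)^2)"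
    by (intro sum_nonneg) simp
  also have "\<dots> = - 3"
    using 2 3 by (simp add: power2_eq_square algebra_simps sum.distrib flip: sum_distrib_left)
  finally show False by simp
qed

lemma not_sos_matrix_Mlam: "\<not> sos_matrix (Mlam l)"
proof
  assume "sos_matrix (Mlam l)"
  then obtain r :: nat and U :: "nat \<Rightarrow> poly3^3^3" where M: "Mlam l = (\<Sum>i<r. transpose (U i) ** U i)"
    unfolding sos_matrix_def by blast
  let ?I = "{..<r} \<times> (UNIV :: 3 set)"
  have "(\<Sum>x\<in>?I. (case x of (i, k) \<Rightarrow> U i $ k $ a) * (case x of (i, k) \<Rightarrow> U i $ k $ b)) = Mlam l $ a $ b" for a b
    unfolding M by (simp add: matrix_matrix_mult_def transpose_def sum.cartesian_product case_prod_unfold)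
  from Mlam_not_gram_matrix[OF _ this this this this this this] show False by simp
qed

text \<open>In a sum of squares, the coefficient at \<open>2m\<close> is the sum of the squared coefficients at \<open>m\<close>
  as soon as, for every other splitting \<open>2m = a + b\<close>, the coefficients at \<open>a\<close> or those at \<open>b\<close>
  are already known to vanish. Climbing in the degree, this excludes from the squared polynomials one
  member of every pair of monomials with product \<open>x\<^sup>2y\<^sup>2z\<^sup>2\<close>, except the pair of \<open>xyz\<close> with
  itself.\<close>

lemma not_sos_poly_det_Mlam_0: "\<not> sos_poly (det (Mlam 0))"
proof
  assume "sos_poly (det (Mlam 0))"
  then obtain r :: nat and g where g: "det (Mlam 0) = (\<Sum>i<r. g i * g i)"
    unfolding sos_poly_def power2_eq_square by blast
  have det: "det (Mlam 0) = Poly_Mapping.single (exps 2 2 2) (-3) + Poly_Mapping.single (exps 4 2 0) 1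
      + Poly_Mapping.single (exps 0 4 2) 1 + Poly_Mapping.single (exps 2 0 4) 1"
    by (simp add: det_Mlam Var_exps Const_exps power2_eq_square mult_single exps_add distrib_left exps_0[symmetric])
      (simp add: numeral_eq_Suc ac_simps)
  have e: "(\<Sum>i<r. coef (g i * g i) a b c) = (if a = 2 \<and> b = 2 \<and> c = 2 then - 3 else 0) +
     (if a = 4 \<and> b = 2 \<and> c = 0 then 1 else 0) + (if a = 0 \<and> b = 4 \<and> c = 2 then 1 else 0)
     + (if a = 2 \<and> b = 0 \<and> c = 4 then 1 else 0)" for a b c
  proof -
    have "(\<Sum>i<r. coef (g i * g i) a b c) = coef (det (Mlam 0)) a b c" by (simp add: g)
    then show ?thesis unfolding det by (simp only: coef_simps coef_single)
  qed
  have sq: "(\<Sum>i<r. q i * q i) = 0 \<Longrightarrow> \<forall>i<r. q i = 0" for q :: "nat \<Rightarrow> real"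
    by (simp add: sum_nonneg_eq_0_iff)
  note s = coef_mult eval_nat_numeral
  have 0: "\<forall>i<r. coef (g i) 0 0 0 = 0"
    using e[of 0 0 0] by (auto simp: s intro!: sq)
  have 1: "\<forall>i<r. coef (g i) (Suc 0) 0 0 = 0" "\<forall>i<r. coef (g i) 0 (Suc 0) 0 = 0" "\<forall>i<r. coef (g i) 0 0 (Suc 0) = 0"
    using e[of 2 0 0] e[of 0 2 0] e[of 0 0 2] 0 by (auto simp: s intro!: sq)
  have 2: "\<forall>i<r. coef (g i) 2 0 0 = 0" "\<forall>i<r. coef (g i) 0 2 0 = 0" "\<forall>i<r. coef (g i) 0 0 2 = 0"
    using e[of 4 0 0] e[of 0 4 0] e[of 0 0 4] 0 1 by (auto simp: s intro!: sq)
  have 3: "\<forall>i<r. coef (g i) 3 0 0 = 0" "\<forall>i<r. coef (g i) 0 3 0 = 0" "\<forall>i<r. coef (g i) 0 0 3 = 0"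
    using e[of 6 0 0] e[of 0 6 0] e[of 0 0 6] 0 1 2 by (auto simp: s intro!: sq)
  have 11: "\<forall>i<r. coef (g i) 1 1 0 = 0" "\<forall>i<r. coef (g i) 1 0 1 = 0" "\<forall>i<r. coef (g i) 0 1 1 = 0"
    using e[of 2 2 0] e[of 2 0 2] e[of 0 2 2] 0 1 2 by (auto simp: s intro!: sq)
  have 12: "\<forall>i<r. coef (g i) 1 2 0 = 0" "\<forall>i<r. coef (g i) 2 0 1 = 0" "\<forall>i<r. coef (g i) 0 1 2 = 0"
    using e[of 2 4 0] e[of 4 0 2] e[of 0 2 4] 0 1 2 3 11 by (auto simp: s intro!: sq)
  \<comment> \<open>Of the 27 exponents \<open>m \<le> (2, 2, 2)\<close> only \<open>(1, 1, 1)\<close> still contributes.\<close>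
  have "(\<Sum>i<r. coef (g i) 1 1 1 * coef (g i) 1 1 1) = -3"
    using e[of 2 2 2] 0 1 2 3 11 12 by (auto simp: s)
  moreover have "0 \<le> (\<Sum>i<r. coef (g i) 1 1 1 * coef (g i) 1 1 1)" by (intro sum_nonneg) simp
  ultimately show False by simp
qed

section \<open>Semi-certificates imply semi-definiteness\<close>

lemma psd_sum_scaled_squares:
  fixes f :: "nat \<Rightarrow> real" and A :: "nat \<Rightarrow> real^3^3"
  assumes "\<And>j. j < n \<Longrightarrow> 0 \<le> f j"
  shows "psd (\<Sum>j<n. f j *\<^sub>R (transpose (A j) ** A j))"
  using assms
proof (induction n)
  case 0
  then show ?case by (simp add: psd_def transpose_def vec_eq_iff)
next
  case (Suc n)
  let ?B = "\<Sum>j<n. f j *\<^sub>R (transpose (A j) ** A j)"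
  have IH: "psd ?B" using Suc by simp
  have "v \<bullet> ((transpose (A n) ** A n) *v v) = (A n *v v) \<bullet> (A n *v v)" for v
    by (metis dot_lmul_matrix inner_commute matrix_vector_mul_assoc transpose_matrix_vector)
  then have "0 \<le> v \<bullet> ((?B + f n *\<^sub>R (transpose (A n) ** A n)) *v v)" for v
    using IH Suc.prems[of n]
    by (simp add: psd_def matrix_vector_mult_add_rdistrib inner_add_right flip: scaleR_matrix_vector_assoc)
  moreover have "transpose (?B + f n *\<^sub>R (transpose (A n) ** A n)) = ?B + f n *\<^sub>R (transpose (A n) ** A n)"
  proof -
    have t: "transpose (X + Y) = transpose X + transpose Y" for X Y :: "real^3^3"
      by (simp add: transpose_def vec_eq_iff)
    show ?thesis using IH by (simp add: t psd_def transpose_scalar matrix_transpose_mul)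
  qed
  ultimately show ?case by (simp add: psd_def)
qed

lemma semi_certificate_imp_psd:
  assumes "semi_certificate M" shows "psd_matrix_poly M"
  unfolding psd_matrix_poly_def
proof
  fix p
  from assms obtain d and r :: nat and S :: "nat \<Rightarrow> (real^3) set" where cover: "(\<Union>i<r. S i) = UNIV"
    and cert: "\<forall>i<r. semialgebraic (S i) \<and> (\<exists>(n::nat) (f :: nat \<Rightarrow> poly3) (U :: nat \<Rightarrow> poly3^3^3).
       (\<forall>j<n. \<exists>a b. form a (f j) \<and> mform b (U j) \<and> a + 2 * b = d) \<and>
       (\<forall>p\<in>S i. meval M p = (\<Sum>j<n. peval (f j) p *\<^sub>R (transpose (meval (U j) p) ** meval (U j) p)) \<and>
          (\<forall>j<n. 0 \<le> peval (f j) p)))"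
    unfolding semi_certificate_def by (elim conjE exE) (rule that)
  from cover obtain i where "i < r" "p \<in> S i" by blast
  from cert[rule_format, OF this(1)] this(2) obtain n :: nat and f :: "nat \<Rightarrow> poly3" and U :: "nat \<Rightarrow> poly3^3^3"
    where "meval M p = (\<Sum>j<n. peval (f j) p *\<^sub>R (transpose (meval (U j) p) ** meval (U j) p))"
      and "\<forall>j<n. 0 \<le> peval (f j) p"
    by (elim conjE exE) (drule bspec, assumption, blast)
  then show "psd (meval M p)" by (simp add: psd_sum_scaled_squares)
qed

section \<open>Certificates by weighted squares of rows\<close>

lemma meval_nth: "meval M p $ i $ j = peval (M $ i $ j) p"
  by (simp add: meval_def)

definition square_degree :: "nat \<Rightarrow> poly3 \<Rightarrow> poly3^3 \<Rightarrow> bool"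
  where "square_degree d f w \<longleftrightarrow> (\<exists>a b. form a f \<and> (\<forall>i. form b (w $ i)) \<and> a + 2 * b = d)"

text \<open>A list of pairs \<open>(f, w)\<close> stands for the matrix \<open>\<Sum> f w w\<^sup>T\<close>, the case of a semi-certificate in
  which every matrix has a single non-zero row. Comparing entries then replaces matrix algebra.\<close>

definition certifies :: "nat \<Rightarrow> poly3^3^3 \<Rightarrow> (real^3) set \<Rightarrow> (poly3 \<times> (poly3^3)) list \<Rightarrow> bool"
  where "certifies d M S xs \<longleftrightarrow>
    (\<forall>(f, w) \<in> set xs. square_degree d f w \<and> (\<forall>p\<in>S. 0 \<le> peval f p)) \<and>
    (\<forall>p\<in>S. \<forall>i j. peval (M $ i $ j) p =
      (\<Sum>(f, w)\<leftarrow>xs. peval f p * (peval (w $ i) p * peval (w $ j) p)))"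

definition row_matrix :: "poly3^3 \<Rightarrow> poly3^3^3"
  where "row_matrix w = (\<chi> k. if k = 1 then w else 0)"

lemma row_matrix_square:
  "(transpose (meval (row_matrix w) p) ** meval (row_matrix w) p) $ i $ j = peval (w $ i) p * peval (w $ j) p"
  by (simp add: matrix_matrix_mult_def transpose_def meval_def row_matrix_def sum_3)

lemma semi_certificateI:
  assumes sym: "transpose M = M" and deg: "mform d M"
    and fin: "finite \<S>" and cover: "\<Union>\<S> = UNIV"
    and sa: "\<And>S. S \<in> \<S> \<Longrightarrow> semialgebraic S" and cert: "\<And>S. S \<in> \<S> \<Longrightarrow> \<exists>xs. certifies d M S xs"
  shows "semi_certificate M"
proof -
  have *: "\<exists>(n::nat) (f :: nat \<Rightarrow> poly3) (U :: nat \<Rightarrow> poly3^3^3).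
      (\<forall>j<n. \<exists>a b. form a (f j) \<and> mform b (U j) \<and> a + 2 * b = d) \<and>
      (\<forall>p\<in>S. meval M p = (\<Sum>j<n. peval (f j) p *\<^sub>R (transpose (meval (U j) p) ** meval (U j) p)) \<and>
        (\<forall>j<n. 0 \<le> peval (f j) p))" if S: "S \<in> \<S>" for S
  proof -
    obtain xs where xs: "certifies d M S xs" using cert[OF S] by blast
    have mem: "(\<exists>a b. form a (fst (xs ! j)) \<and> (\<forall>i. form b (snd (xs ! j) $ i)) \<and> a + 2 * b = d) \<and>
        (\<forall>p\<in>S. 0 \<le> peval (fst (xs ! j)) p)" if "j < length xs" for j
      using xs nth_mem[OF that] unfolding certifies_def square_degree_def by (auto simp: case_prod_unfold)
    have row: "mform b (row_matrix w)" if "\<forall>i. form b (w $ i)" for b w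
      using that by (simp add: mform_def row_matrix_def)
    have "meval M p = (\<Sum>j<length xs. peval (fst (xs ! j)) p *\<^sub>R
        (transpose (meval (row_matrix (snd (xs ! j))) p) ** meval (row_matrix (snd (xs ! j))) p))"
      if "p \<in> S" for p
      using xs that
      by (simp add: certifies_def vec_eq_iff row_matrix_square sum_list_sum_nth case_prod_unfold
          atLeast0LessThan meval_nth sum_component)
    with mem row show ?thesis
      by (intro exI[of _ "length xs"] exI[of _ "\<lambda>j. fst (xs ! j)"] exI[of _ "\<lambda>j. row_matrix (snd (xs ! j))"]) blast
  qed
  obtain h where h: "bij_betw h {0..<card \<S>} \<S>"
    using ex_bij_betw_nat_finite[OF fin] by blast
  then have h': "h ` {..<card \<S>} = \<S>" by (simp add: bij_betw_def atLeast0LessThan)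
  then have cover': "(\<Union>i<card \<S>. h i) = UNIV" using cover by simp
  have mem: "h i \<in> \<S>" if "i < card \<S>" for i using h' that by blast
  show ?thesis
    unfolding semi_certificate_def
  proof (rule conjI, rule sym, rule exI[of _ d], rule conjI, rule deg, rule exI[of _ "card \<S>"],
      rule exI[of _ h], rule conjI, rule cover', intro allI impI conjI)
    fix i assume "i < card \<S>"
    then have "h i \<in> \<S>" by (rule mem)
    then show "semialgebraic (h i)" by (rule sa)
    from \<open>h i \<in> \<S>\<close> show "\<exists>(n::nat) (f :: nat \<Rightarrow> poly3) (U :: nat \<Rightarrow> poly3^3^3).
        (\<forall>j<n. \<exists>a b. form a (f j) \<and> mform b (U j) \<and> a + 2 * b = d) \<and>
        (\<forall>p\<in>h i. meval M p =
            (\<Sum>j<n. peval (f j) p *\<^sub>R (transpose (meval (U j) p) ** meval (U j) p)) \<and>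
          (\<forall>j<n. 0 \<le> peval (f j) p))"
      by (rule * )
  qed
qed

section \<open>The corner regions\<close>

lemma form_2: "form 2 (Var i * Var j)" "form 2 ((Var i)\<^sup>2)" "form d f \<Longrightarrow> form d (Const c * f)"
  using form_mult[of "Suc 0" "Var i" "Suc 0" "Var j"] form_power[of "Suc 0" "Var i" 2] form_mult[of 0 "Const c" d f]
  by (simp_all add: numeral_2_eq_2)

lemma transpose_Mlam: "transpose (Mlam l) = Mlam l"
  by (simp add: transpose_def vec_eq_iff Mlam_nth mult.commute)

lemma mform_Mlam: "mform 2 (Mlam l)"
  by (auto simp: mform_def Mlam_nth intro!: form_add form_2)

lemma semialgebraic_Collect_le: "semialgebraic {p. peval f p \<le> peval g p}"
proof -
  have "{p. peval f p \<le> peval g p} = - {p. 0 < peval (f - g) p}" by auto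
  then show ?thesis by (metis semialgebraic.pos semialgebraic.compl)
qed

definition corner_region :: "real \<Rightarrow> 3 \<Rightarrow> (real^3) set"
  where "corner_region l i = {p. 4 * (p $ (i + 2))\<^sup>2 \<le> (l + 1)\<^sup>2 * (p $ i)\<^sup>2}"

text \<open>For \<open>i = 1\<close> and \<open>\<mu> = l + 1\<close>, the form \<open>v\<^sup>T M v\<close> is
  \<open>(xa - yb - zc)\<^sup>2 + \<mu>z\<^sup>2a\<^sup>2 + (\<mu>x\<^sup>2b\<^sup>2 - 4yzbc + \<mu>y\<^sup>2c\<^sup>2)\<close>. For \<open>\<mu> > 0\<close>,
  completing the square in \<open>c\<close> turns the bracket into \<open>\<mu>(yc - (2/\<mu>)zb)\<^sup>2 + (\<mu>x\<^sup>2 - (4/\<mu>)z\<^sup>2)b\<^sup>2\<close>, and the last weight is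
  non-negative exactly on the corner region.\<close>

definition corner_certificate :: "real \<Rightarrow> 3 \<Rightarrow> (poly3 \<times> (poly3^3)) list"
  where "corner_certificate l i =
    [(1, \<chi> m. if m = i then Var m else - Var m),
     (Const (l + 1) * (Var (i + 2))\<^sup>2, axis i 1),
     (Const (l + 1), \<chi> m. if m = i + 1 then - (Const (2 / (l + 1)) * Var (i + 2))
       else if m = i + 2 then Var (i + 1) else 0),
     (Const (l + 1) * (Var i)\<^sup>2 - Const (4 / (l + 1)) * (Var (i + 2))\<^sup>2, axis (i + 1) 1)]"

lemma corner_certifies:
  assumes "l > 0"
  shows "certifies 2 (Mlam l) (corner_region l i) (corner_certificate l i)"
proof -
  have axis: "form 0 (axis a 1 $ m)" for a m :: 3 by (simp add: axis_def)
  have e: "peval (Mlam l $ m $ n) p =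
      (\<Sum>(f, w)\<leftarrow>corner_certificate l i. peval f p * (peval (w $ m) p * peval (w $ n) p))" for m n p
    using assms exhaust_3[of i] exhaust_3[of m] exhaust_3[of n]
    by (elim disjE) (simp_all add: corner_certificate_def peval_Mlam axis_def power2_eq_square)
  have nonneg: "0 \<le> (l + 1) * (p $ i)\<^sup>2 - 4 / (l + 1) * (p $ (i + 2))\<^sup>2"
    if "p \<in> corner_region l i" for p
    using that assms by (simp add: corner_region_def field_simps power2_eq_square)
  have l1: "square_degree 2 1 (\<chi> m. if m = i then Var m else - Var m)"
    unfolding square_degree_def by (rule exI[of _ 0], rule exI[of _ 1]) simp
  have l2: "square_degree 2 (Const (l + 1)) (\<chi> m. if m = i + 1 then - (Const (2 / (l + 1)) * Var (i + 2))
      else if m = i + 2 then Var (i + 1) else 0)"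
    unfolding square_degree_def by (rule exI[of _ 0], rule exI[of _ 1]) (simp add: form_2)
  have c: "square_degree 2 f (axis k 1)" if "form 2 f" for f and k :: 3
    unfolding square_degree_def by (rule exI[of _ 2], rule exI[of _ 0]) (simp add: axis that)
  have "\<forall>(f, w) \<in> set (corner_certificate l i). square_degree 2 f w \<and>
      (\<forall>p\<in>corner_region l i. 0 \<le> peval f p)"
    using assms nonneg l1 l2 by (auto simp: corner_certificate_def intro!: c form_2 form_diff)
  with e show ?thesis by (simp add: certifies_def)
qed

section \<open>Certificates away from the coordinate planes\<close>

text \<open>The weights of this certificate are \<open>(M w)\<^sub>i / w\<^sub>i\<close> for the squares of the coordinates, and
  \<open>-M\<^sub>i\<^sub>j w\<^sub>i w\<^sub>j\<close> for the squares of the differences \<open>v\<^sub>i/w\<^sub>i - v\<^sub>j/w\<^sub>j\<close>; the three pairs \<open>{i, j}\<close> are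
  \<open>{i, i + 1}\<close>. The decomposition is an identity for every symmetric matrix, and it is a certificate
  where all weights are non-negative.\<close>

definition interior_certificate :: "real \<Rightarrow> real^3 \<Rightarrow> (poly3 \<times> (poly3^3)) list"
  where "interior_certificate l w = concat (map (\<lambda>i.
    [(Const (1 / w $ i) * (\<Sum>j\<in>UNIV. Const (w $ j) * Mlam l $ i $ j), axis i 1),
     (Const (w $ i * w $ (i + 1)) * (Var i * Var (i + 1)),
       \<chi> j. if j = i then Const (1 / w $ i)
         else if j = i + 1 then - Const (1 / w $ (i + 1)) else 0)]) [1, 2, 3])"

lemma interior_certificate_identity:
  assumes "\<And>i. w $ i \<noteq> 0"
  shows "peval (Mlam l $ m $ n) p =
    (\<Sum>(f, u)\<leftarrow>interior_certificate l w. peval f p * (peval (u $ m) p * peval (u $ n) p))"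
  using assms exhaust_3[of m] exhaust_3[of n]
  by (elim disjE) (simp_all add: interior_certificate_def peval_Mlam axis_def sum_3 power2_eq_square
      add_divide_distrib diff_divide_distrib)

lemma interior_certificate_forms:
  assumes "(f, u) \<in> set (interior_certificate l w)"
  shows "form 2 f \<and> (\<forall>i. form 0 (u $ i))"
proof -
  have M: "form 2 (\<Sum>j\<in>UNIV. Const (w $ j) * Mlam l $ i $ j)" for i
    using mform_Mlam unfolding sum_3 mform_def by (intro form_add form_2) auto
  show ?thesis using assms
    by (auto simp: interior_certificate_def axis_def intro!: form_2 M)
qed

definition interior_region :: "real \<Rightarrow> real^3 \<Rightarrow> (real^3) set"
  where "interior_region l w = {p. \<forall>f \<in> fst ` set (interior_certificate l w). 0 < peval f p}"

lemma semialgebraic_Collect_pos: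
  assumes "finite F" shows "semialgebraic {p. \<forall>f\<in>F. 0 < peval f p}"
  using assms
proof induction
  case empty
  then show ?case using semialgebraic.pos[of 1] by simp
next
  case (insert f F)
  have *: "{p. \<forall>g\<in>insert f F. 0 < peval g p} = {p. 0 < peval f p} \<inter> {p. \<forall>g\<in>F. 0 < peval g p}" by auto
  show ?case unfolding * by (rule semialgebraic.inter[OF semialgebraic.pos insert.IH])
qed

lemma open_Collect_pos:
  assumes "finite F" shows "open {p. \<forall>f\<in>F. 0 < peval f p}"
proof -
  have "open {p. 0 < peval f p}" for f
    by (rule open_Collect_less[OF continuous_on_const continuous_on_peval])
  then have "open (\<Inter>f\<in>F. {p. 0 < peval f p})"
    using assms by (intro open_INT) auto
  moreover have "(\<Inter>f\<in>F. {p. 0 < peval f p}) = {p. \<forall>f\<in>F. 0 < peval f p}"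
    by auto
  ultimately show ?thesis by simp
qed

text \<open>The weights are forms, so the regions are cones.\<close>

lemma interior_region_scaleR:
  assumes "t > 0" "t *\<^sub>R p \<in> interior_region l w" shows "p \<in> interior_region l w"
proof -
  have "0 < peval f p" if fu: "(f, u) \<in> set (interior_certificate l w)" for f u
  proof -
    have "0 < peval f (t *\<^sub>R p)" using assms(2) fu by (force simp: interior_region_def)
    then show ?thesis
      using assms(1) peval_form_scaleR[OF conjunct1[OF interior_certificate_forms[OF fu]], of t p]
      by (simp add: zero_less_mult_iff)
  qed
  then show ?thesis by (auto simp: interior_region_def)
qed

lemma interior_certifies:
  assumes "\<And>i. w $ i \<noteq> 0"
  shows "certifies 2 (Mlam l) (interior_region l w) (interior_certificate l w)"
proof -
  have "square_degree 2 f u"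
    if "(f, u) \<in> set (interior_certificate l w)" for f u
    unfolding square_degree_def using interior_certificate_forms[OF that] by (intro exI[of _ 2] exI[of _ 0]) simp
  moreover have "0 \<le> peval f p" if "(f, u) \<in> set (interior_certificate l w)" "p \<in> interior_region l w" for f u p
    using that by (force simp: interior_region_def)
  ultimately show ?thesis
    using interior_certificate_identity[OF assms] by (auto simp: certifies_def)
qed

text \<open>For \<open>l > -1\<close>, an off-diagonal cofactor of \<open>M(p)\<close> is \<open>p\<^sub>i p\<^sub>j\<close> times a positive combination of
  squares, and a diagonal one is such a combination. So
  the \<open>i\<close>-th entry of \<open>adj(M(p)) p\<close> is \<open>p\<^sub>i\<close> times such a combination, namely this one at
  \<open>m = l + 1\<close> and \<open>(p\<^sub>i, p\<^sub>i\<^sub>+\<^sub>1, p\<^sub>i\<^sub>+\<^sub>2)\<close>.\<close>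

definition adjugate_factor :: "real \<Rightarrow> real \<Rightarrow> real \<Rightarrow> real \<Rightarrow> real"
  where "adjugate_factor m x y z = 2 * m * y ^ 4 + 2 * m * x\<^sup>2 * z\<^sup>2 + m\<^sup>2 * x\<^sup>2 * y\<^sup>2 + 4 * y\<^sup>2 * z\<^sup>2"

text \<open>This is a row of the identity \<open>M adj(M) p = det(M) p\<close>.\<close>

lemma adjugate_row:
  "x * adjugate_factor m x y z * (x\<^sup>2 + m * z\<^sup>2) - y * adjugate_factor m y z x * (x * y)
      - z * adjugate_factor m z x y * (x * z) =
    ((m ^ 3 - 4) * x\<^sup>2 * y\<^sup>2 * z\<^sup>2 + m\<^sup>2 * ((x\<^sup>2)\<^sup>2 * y\<^sup>2 + (y\<^sup>2)\<^sup>2 * z\<^sup>2 + (z\<^sup>2)\<^sup>2 * x\<^sup>2)) * x"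
  unfolding adjugate_factor_def by algebra

text \<open>With \<open>w = adj(M(p)) p\<close> the entries of \<open>w\<close> have the signs of the coordinates of \<open>p\<close>, and
  \<open>M(p) w = det(M(p)) p\<close> has the same signs since the determinant is positive for \<open>l > 0\<close>. Hence
  every weight is positive, whatever the octant of \<open>p\<close>.\<close>

lemma in_interior_region:
  assumes "0 < l" and nz: "\<And>i. p $ i \<noteq> 0"
  shows "\<exists>w. (\<forall>i. w $ i \<noteq> 0) \<and> p \<in> interior_region l w"
proof -
  define A where "A i = adjugate_factor (l + 1) (p $ i) (p $ (i + 1)) (p $ (i + 2))" for i
  define w :: "real^3" where "w = (\<chi> i. p $ i * A i)"
  have pos: "0 < A i" for i
    unfolding A_def adjugate_factor_def using assms by (intro add_pos_pos) auto
  have w: "w $ i \<noteq> 0" for i using nz[of i] pos[of i] by (simp add: w_def)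
  have Mw: "(\<Sum>j\<in>UNIV. w $ j * peval (Mlam l $ i $ j) p) = peval (det (Mlam l)) p * p $ i" for i
    using exhaust_3[of i] adjugate_row[of "p $ i" "l + 1" "p $ (i + 1)" "p $ (i + 2)"]
    by (elim disjE) (simp_all add: w_def A_def sum_3 peval_Mlam peval_det_Mlam algebra_simps)
  have 1: "0 < (\<Sum>j\<in>UNIV. w $ j * peval (Mlam l $ i $ j) p) / w $ i" for i
    unfolding Mw using peval_det_Mlam_pos[OF assms] pos[of i] nz[of i] by (simp add: w_def)
  have 2: "0 < w $ i * w $ j * (p $ i * p $ j)" for i j
  proof -
    have "w $ i * w $ j * (p $ i * p $ j) = A i * A j * ((p $ i)\<^sup>2 * (p $ j)\<^sup>2)"
      by (simp add: w_def power2_eq_square)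
    then show ?thesis using pos nz by simp
  qed
  have "p \<in> interior_region l w"
    using 1 2 by (simp add: interior_region_def interior_certificate_def)
  with w show ?thesis by blast
qed

section \<open>Covering by finitely many regions\<close>

lemma semi_certificate_Mlam:
  assumes "0 < l" shows "semi_certificate (Mlam l)"
proof -
  \<comment> \<open>The part of the unit sphere outside the corner regions, enlarged by their boundaries to be
    closed.\<close>
  define K where "K = {p::real^3. norm p = 1 \<and> (\<forall>i. (l + 1)\<^sup>2 * (p $ i)\<^sup>2 \<le> 4 * (p $ (i + 2))\<^sup>2)}"
  \<comment> \<open>On \<open>K\<close> a vanishing coordinate forces the next one to vanish, and so on around the cycle.\<close>
  have nz: "p $ i \<noteq> 0" if "p \<in> K" for p i
  proof
    assume "p $ i = 0"
    have step: "p $ (k + 1) = 0" if "p $ k = 0" for k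
    proof -
      have "(l + 1)\<^sup>2 * (p $ (k + 1))\<^sup>2 \<le> 4 * (p $ (k + 1 + 2))\<^sup>2" using \<open>p \<in> K\<close> by (simp only: K_def) blast
      moreover have "k + 1 + 2 = k" using exhaust_3[of k] by (elim disjE) simp_all
      ultimately have "(l + 1)\<^sup>2 * (p $ (k + 1))\<^sup>2 \<le> 0" using that by simp
      then show ?thesis using assms by (simp add: mult_le_0_iff)
    qed
    have "p $ 1 = 0 \<and> p $ 2 = 0 \<and> p $ 3 = 0"
      using \<open>p $ i = 0\<close> step[of 1] step[of 2] step[of 3] exhaust_3[of i] by auto
    then have "p = 0" by (simp add: vec_eq_iff forall_3)
    with that show False by (simp add: K_def)
  qed
  have K: "K = sphere 0 1 \<inter> (\<Inter>i. {p. (l + 1)\<^sup>2 * (p $ i)\<^sup>2 \<le> 4 * (p $ (i + 2))\<^sup>2})"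
    by (auto simp: K_def)
  have "compact K" unfolding K
    by (intro compact_Int_closed compact_sphere closed_INT ballI closed_Collect_le continuous_intros)
  moreover have "open (interior_region l w)" if "w \<in> {w. \<forall>i. w $ i \<noteq> 0}" for w
    unfolding interior_region_def by (rule open_Collect_pos) simp
  moreover have "K \<subseteq> (\<Union>w\<in>{w. \<forall>i. w $ i \<noteq> 0}. interior_region l w)"
    using in_interior_region[OF assms nz] by blast
  ultimately obtain W where W: "W \<subseteq> {w. \<forall>i. w $ i \<noteq> 0}" "finite W"
      "K \<subseteq> (\<Union>w\<in>W. interior_region l w)"
    by (rule compactE_image)
  let ?\<S> = "range (corner_region l) \<union> interior_region l ` W"
  show ?thesis
  proof (rule semi_certificateI[of _ 2 ?\<S>])
    show "\<Union>?\<S> = UNIV"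
    proof -
      have "p \<in> \<Union>?\<S>" for p
      proof (cases "p \<in> (\<Union>i. corner_region l i)")
        case False
        then have *: "(l + 1)\<^sup>2 * (p $ i)\<^sup>2 \<le> 4 * (p $ (i + 2))\<^sup>2" for i
          by (auto simp: corner_region_def not_le intro: less_imp_le)
        have "p \<noteq> 0" using False by (auto simp: corner_region_def)
        define t where "t = 1 / norm p"
        have t: "t > 0" using \<open>p \<noteq> 0\<close> by (simp add: t_def)
        have "(l + 1)\<^sup>2 * (t * p $ i)\<^sup>2 \<le> 4 * (t * p $ (i + 2))\<^sup>2" for i
          using mult_left_mono[OF *[of i], of "t\<^sup>2"] by (simp add: power_mult_distrib algebra_simps)
        then have "t *\<^sub>R p \<in> K" using \<open>p \<noteq> 0\<close> by (simp add: K_def t_def)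
        then obtain w where "w \<in> W" "t *\<^sub>R p \<in> interior_region l w" using W by blast
        then show ?thesis using interior_region_scaleR[OF t] by blast
      qed blast
      then show ?thesis by blast
    qed
    show "semialgebraic S" if "S \<in> ?\<S>" for S
    proof -
      have "semialgebraic (corner_region l i)" for i
        using semialgebraic_Collect_le[of "Const 4 * (Var (i + 2))\<^sup>2" "Const ((l + 1)\<^sup>2) * (Var i)\<^sup>2"]
        by (simp add: corner_region_def)
      moreover have "semialgebraic (interior_region l w)" for w
        unfolding interior_region_def by (rule semialgebraic_Collect_pos) simp
      ultimately show ?thesis using that by auto
    qed
    show "\<exists>xs. certifies 2 (Mlam l) S xs" if "S \<in> ?\<S>" for S
      using that corner_certifies[OF assms] interior_certifies W(1) by blast
  qed (use W in \<open>auto simp: transpose_Mlam mform_Mlam\<close>)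
qed

section \<open>Semi-definiteness\<close>

lemma psd_Mlam_iff: "psd_matrix_poly (Mlam l) \<longleftrightarrow> 0 \<le> l"
proof
  assume "psd_matrix_poly (Mlam l)"
  then have "0 \<le> 1 \<bullet> (meval (Mlam l) 1 *v (1 :: real^3))"
    by (simp add: psd_matrix_poly_def psd_def)
  then show "0 \<le> l"
    by (simp add: meval_def peval_Mlam inner_vec_def matrix_vector_mult_def sum_3)
next
  assume "0 \<le> l"
  \<comment> \<open>The form is affine in \<open>l\<close> and non-negative for all larger parameters; this includes the
    boundary case \<open>l = 0\<close>.\<close>
  have "0 \<le> v \<bullet> (meval (Mlam l) p *v v)" for p v
  proof -
    define R where "R = (p $ 3)\<^sup>2 * (v $ 1)\<^sup>2 + (p $ 1)\<^sup>2 * (v $ 2)\<^sup>2 + (p $ 2)\<^sup>2 * (v $ 3)\<^sup>2"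
    have "v \<bullet> (meval (Mlam (l + e)) p *v v) = v \<bullet> (meval (Mlam l) p *v v) + e * R" for e
      by (simp add: R_def meval_def peval_Mlam inner_vec_def matrix_vector_mult_def sum_3 algebra_simps power2_eq_square)
    moreover have "0 \<le> v \<bullet> (meval (Mlam (l + e)) p *v v)" if "0 < e" for e
      using semi_certificate_imp_psd[OF semi_certificate_Mlam, of "l + e"] \<open>0 \<le> l\<close> that
      by (simp add: psd_matrix_poly_def psd_def)
    ultimately have "0 \<le> v \<bullet> (meval (Mlam l) p *v v) + e * R" if "0 < e" for e using that by metis
    moreover have "((\<lambda>e. v \<bullet> (meval (Mlam l) p *v v) + e * R) \<longlongrightarrow>
        v \<bullet> (meval (Mlam l) p *v v) + 0 * R) (at_right 0)"
      by (intro tendsto_intros)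
    ultimately have "0 \<le> v \<bullet> (meval (Mlam l) p *v v) + 0 * R"
      by (intro tendsto_lowerbound[of _ _ "at_right 0"]) (auto intro: eventually_at_rightI[of 0 1])
    then show ?thesis by simp
  qed
  moreover have "transpose (meval (Mlam l) p) = meval (Mlam l) p" for p
    by (simp add: transpose_def vec_eq_iff meval_def peval_Mlam mult.commute)
  ultimately show "psd_matrix_poly (Mlam l)" by (simp add: psd_matrix_poly_def psd_def)
qed

theorem proposition6p1:
  shows "(\<forall>l::real. \<not> sos_matrix (Mlam l))
    \<and> (\<forall>l::real. psd_matrix_poly (Mlam l) \<longleftrightarrow> l \<in> {0..})
    \<and> ((\<forall>p. 0 \<le> peval (det (Mlam 0)) p) \<and> \<not> sos_poly (det (Mlam 0)))
    \<and> (\<forall>l::real. l \<in> {0<..} \<longrightarrow> semi_certificate (Mlam l))"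
  using not_sos_matrix_Mlam psd_Mlam_iff peval_det_Mlam_ge[of 0] not_sos_poly_det_Mlam_0 semi_certificate_Mlam
  by simp

end
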